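(* Let $R$ be a reduced commutative ring with unity having more than two minimal prime ideals. Then $gr(\mathbb{AG}(R))=3$.
   Context: $\mathbb{AG}(R)$ is the annihilating-ideal graph of the commutative ring $R$ with unity: its vertices are the non-zero ideals $I$ of $R$ for which there exists a non-zero ideal $J$ of $R$ with $IJ=(0)$, and two distinct vertices $I,J$ are adjacent iff $IJ=(0)$. The girth $gr(G)$ of a graph $G$ is the length of its shortest cycle ($\infty$ if there is none). *)

theory Defs
  imports
    "HOL-Algebra.Ideal_Product"
    "HOL-Library.Extended_Nat"
    "Graph_Theory.Pair_Digraph"
begin

definition reduced_ring :: "('a, 'b) ring_scheme \<Rightarrow> bool" where
  "reduced_ring R \<longleftrightarrow>
     (\<forall>x \<in> carrier R. \<forall>n :: nat. x [^]\<^bsub>R\<^esub> n = \<zero>\<^bsub>R\<^esub> \<longrightarrow> x = \<zero>\<^bsub>R\<^esub>)"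

definition minimal_primes :: "('a, 'b) ring_scheme \<Rightarrow> 'a set set" where
  "minimal_primes R =
     {P. primeideal P R \<and> (\<forall>Q. primeideal Q R \<longrightarrow> Q \<subseteq> P \<longrightarrow> Q = P)}"

definition annihilating_ideals :: "('a, 'b) ring_scheme \<Rightarrow> 'a set set" where
  "annihilating_ideals R =
     {I. ideal I R \<and> I \<noteq> {\<zero>\<^bsub>R\<^esub>} \<and>
         (\<exists>J. ideal J R \<and> J \<noteq> {\<zero>\<^bsub>R\<^esub>} \<and> I \<cdot>\<^bsub>R\<^esub> J = {\<zero>\<^bsub>R\<^esub>})}"

(* An undirected edge is represented by the two arcs (I, J) and (J, I). *)
definition annihilating_ideal_graph :: "('a, 'b) ring_scheme \<Rightarrow> 'a set pair_pre_digraph" where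
  "annihilating_ideal_graph R =
     \<lparr> pverts = annihilating_ideals R,
       parcs = {(I, J). I \<in> annihilating_ideals R \<and> J \<in> annihilating_ideals R \<and>
                        I \<noteq> J \<and> I \<cdot>\<^bsub>R\<^esub> J = {\<zero>\<^bsub>R\<^esub>}} \<rparr>"

(* Intended for symmetric loop-free digraphs without parallel arcs, that is, simple graphs.
   The directed notion of cycle counts u, v, u as a cycle of length 2; the bound on the length
   excludes these, and leaves exactly the cycles of the undirected graph.
   The infimum of the empty set is infinity. *)
definition girth :: "('a, 'b) pre_digraph \<Rightarrow> enat" where
  "girth G = Inf {enat (length p) | p. pre_digraph.cycle G p \<and> 3 \<le> length p}"

lemma (in cring) pair_bidirected_digraph_annihilating_ideal_graph:
  "pair_bidirected_digraph (annihilating_ideal_graph R)"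
proof -
  have "(J, I) \<in> parcs (annihilating_ideal_graph R)"
    if "(I, J) \<in> parcs (annihilating_ideal_graph R)" for I J
  proof -
    from that have *: "I \<in> annihilating_ideals R" "J \<in> annihilating_ideals R" "I \<noteq> J"
      "I \<cdot>\<^bsub>R\<^esub> J = {\<zero>\<^bsub>R\<^esub>}"
      by (simp_all add: annihilating_ideal_graph_def)
    then have "J \<cdot>\<^bsub>R\<^esub> I = I \<cdot>\<^bsub>R\<^esub> J"
      by (intro ideal_prod_commute) (simp_all add: annihilating_ideals_def)
    with * show ?thesis
      by (simp add: annihilating_ideal_graph_def)
  qed
  moreover have "arcs_ends (with_proj (annihilating_ideal_graph R)) =
      parcs (annihilating_ideal_graph R)"
    by (auto simp: arcs_ends_def arc_to_ends_def with_proj_def)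
  ultimately have "symmetric (with_proj (annihilating_ideal_graph R))"
    unfolding symmetric_def sym_def by metis
  then show ?thesis
    by unfold_locales (simp_all add: annihilating_ideal_graph_def case_prod_beta)
qed

end

theory Submission
  imports
    Defs
    "HOL-Algebra.Ring_Divisibility"
begin

text \<open>
  A triangle in the annihilating-ideal graph can be made of principal ideals: it suffices to find
  non-zero elements \<open>x\<close>, \<open>y\<close>, \<open>z\<close> whose pairwise products vanish. The three ideals are then
  distinct because the ring is reduced: if \<open>x\<close> and \<open>y\<close> generate the same ideal, then \<open>x\<close> is a
  multiple of \<open>y\<close>, so \<open>x\<^sup>2\<close> is a multiple of \<open>x y = 0\<close>, whence \<open>x = 0\<close>.

  Three minimal primes \<open>P\<^sub>1\<close>, \<open>P\<^sub>2\<close>, \<open>P\<^sub>3\<close> provide such elements. Any two distinct minimal primes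
  \<open>P\<close>, \<open>Q\<close> can be separated: there are \<open>a \<notin> P\<close> and \<open>b \<notin> Q\<close> with \<open>a b = 0\<close>. Otherwise the
  products \<open>a b\<close> form a multiplicative system without zero, Krull's theorem
  (\<open>Krull_prime_avoiding_submonoid\<close>) gives a prime disjoint from it, and this prime lies in both
  \<open>P\<close> and \<open>Q\<close>, so by minimality equals both. Separating the three pairs and taking \<open>x\<close> to be the
  product of the two elements found outside \<open>P\<^sub>1\<close>, and likewise \<open>y\<close> outside \<open>P\<^sub>2\<close> and \<open>z\<close>
  outside \<open>P\<^sub>3\<close>, gives elements that are non-zero by primality, and each two of them contain
  complementary factors of a vanishing product.
\<close>

text \<open>
  An ideal maximal among those avoiding the submonoid is prime: if it contains \<open>a b\<close> but neither
  factor, enlarging it by \<open>a\<close> and by \<open>b\<close> yields two elements of the submonoid, and their product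
  lies in the ideal.
\<close>

lemma (in cring) Krull_prime_avoiding_submonoid:
  assumes S: "submonoid S R" and zero: "\<zero> \<notin> S"
  obtains P where "primeideal P R" and "P \<inter> S = {}"
proof -
  let ?A = "{I. ideal I R \<and> I \<inter> S = {}}"
  have "\<exists>M\<in>?A. \<forall>X\<in>?A. M \<subseteq> X \<longrightarrow> X = M"
  proof (rule subset_Zorn_nonempty)
    show "?A \<noteq> {}" using zeroideal zero by blast
  next
    fix C assume "C \<noteq> {}" and C: "subset.chain ?A C"
    have "subset.chain {I. ideal I R} C"
      using C by (auto simp: pred_on.chain_def)
    from chain_Union_is_ideal[OF this] have "ideal (\<Union>C) R"
      using \<open>C \<noteq> {}\<close> by simp
    moreover have "\<Union>C \<inter> S = {}"
      using C by (auto simp: pred_on.chain_def)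
    ultimately show "\<Union>C \<in> ?A" by simp
  qed
  then obtain M where "M \<in> ?A" and *: "\<forall>X\<in>?A. M \<subseteq> X \<longrightarrow> X = M" ..
  then have M: "ideal M R" "M \<inter> S = {}" by simp_all
  have max: "X = M" if "ideal X R" "X \<inter> S = {}" "M \<subseteq> X" for X
    using * that by simp
  interpret M: ideal M R by (rule M)
  have meets: "\<exists>m\<in>M. \<exists>r\<in>carrier R. m \<oplus> r \<otimes> a \<in> S" if a: "a \<in> carrier R" "a \<notin> M" for a
  proof -
    define N where "N = set_add R M (PIdl a)"
    have N: "x \<in> N \<longleftrightarrow> (\<exists>m\<in>M. \<exists>r\<in>carrier R. x = m \<oplus> r \<otimes> a)" for x
      unfolding N_def set_add_def' cgenideal_def by blast
    have "ideal N R"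
      unfolding N_def by (rule add_ideals[OF M(1) cgenideal_ideal[OF a(1)]])
    moreover have "M \<subseteq> N"
    proof
      fix m assume "m \<in> M"
      then have "m = m \<oplus> \<zero> \<otimes> a" using M.Icarr a(1) by simp
      with \<open>m \<in> M\<close> show "m \<in> N" unfolding N by blast
    qed
    moreover have "a \<in> N"
    proof -
      have "a = \<zero> \<oplus> \<one> \<otimes> a" using a(1) by simp
      then show ?thesis unfolding N using M.zero_closed one_closed by blast
    qed
    ultimately have "N \<inter> S \<noteq> {}" using max a(2) by blast
    then obtain x where "x \<in> N" "x \<in> S" by blast
    then show ?thesis unfolding N by blast
  qed
  have "primeideal M R"
  proof (rule primeidealI[OF M(1) is_cring])
    show "carrier R \<noteq> M"
      using M(2) submonoid.one_closed[OF S] by blast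
  next
    fix a b assume ab: "a \<in> carrier R" "b \<in> carrier R" "a \<otimes> b \<in> M"
    show "a \<in> M \<or> b \<in> M"
    proof (rule ccontr)
      assume "\<not> (a \<in> M \<or> b \<in> M)"
      then have ab_notin: "a \<notin> M" "b \<notin> M" by simp_all
      obtain m r where m: "m \<in> M" "r \<in> carrier R" "m \<oplus> r \<otimes> a \<in> S"
        using meets[OF ab(1) ab_notin(1)] by blast
      obtain n s where n: "n \<in> M" "s \<in> carrier R" "n \<oplus> s \<otimes> b \<in> S"
        using meets[OF ab(2) ab_notin(2)] by blast
      have carr: "m \<in> carrier R" "n \<in> carrier R" using m n M.Icarr by auto
      have "(m \<oplus> r \<otimes> a) \<otimes> (n \<oplus> s \<otimes> b) =
          m \<otimes> (n \<oplus> s \<otimes> b) \<oplus> ((r \<otimes> a) \<otimes> n \<oplus> (r \<otimes> s) \<otimes> (a \<otimes> b))"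
        using ab carr m n by algebra
      also have "\<dots> \<in> M"
        using ab carr m n by (simp add: M.a_closed M.I_l_closed M.I_r_closed)
      finally show False
        using submonoid.m_closed[OF S m(3) n(3)] M(2) by blast
    qed
  qed
  with M(2) that show ?thesis by blast
qed

text \<open>
  The products \<open>a b\<close> with \<open>a \<notin> P\<close> and \<open>b \<notin> Q\<close> form a multiplicative system. A prime of the
  localisation of \<open>R\<close> at this system would come from a prime of \<open>R\<close> contained in \<open>P \<inter> Q\<close>, which
  minimality excludes as \<open>P \<noteq> Q\<close>; so the localisation is zero, that is, \<open>0\<close> belongs to the system.
\<close>

lemma (in cring) separate_minimal_primes:
  assumes P: "P \<in> minimal_primes R" and Q: "Q \<in> minimal_primes R" and "P \<noteq> Q"
  obtains a b where "a \<in> carrier R - P" and "b \<in> carrier R - Q" and "a \<otimes> b = \<zero>"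
proof -
  interpret P: primeideal P R using P by (simp add: minimal_primes_def)
  interpret Q: primeideal Q R using Q by (simp add: minimal_primes_def)
  let ?S = "{a \<otimes> b | a b. a \<in> carrier R - P \<and> b \<in> carrier R - Q}"
  have P1: "\<one> \<in> carrier R - P" using P.one_imp_carrier P.I_notcarr by auto
  have Q1: "\<one> \<in> carrier R - Q" using Q.one_imp_carrier Q.I_notcarr by auto
  have S: "submonoid ?S R"
  proof
    show "?S \<subseteq> carrier R" by auto
  next
    show "\<one> \<in> ?S" using P1 Q1 r_one[OF one_closed] by (intro CollectI exI[of _ \<one>]) auto
  next
    fix x y assume "x \<in> ?S" "y \<in> ?S"
    then obtain a b c d where
      *: "x = a \<otimes> b" "y = c \<otimes> d" "a \<in> carrier R - P" "c \<in> carrier R - P"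
        "b \<in> carrier R - Q" "d \<in> carrier R - Q"
      by blast
    then have "a \<otimes> c \<in> carrier R - P" "b \<otimes> d \<in> carrier R - Q"
      using P.I_prime Q.I_prime by auto
    moreover have "x \<otimes> y = (a \<otimes> c) \<otimes> (b \<otimes> d)"
      using * by (auto simp: m_ac)
    ultimately show "x \<otimes> y \<in> ?S" by blast
  qed
  have "\<zero> \<in> ?S"
  proof (rule ccontr)
    assume "\<zero> \<notin> ?S"
    with S obtain T where T: "primeideal T R" "T \<inter> ?S = {}"
      by (rule Krull_prime_avoiding_submonoid)
    interpret T: primeideal T R by (rule T)
    \<comment> \<open>The system contains the complements of \<open>P\<close> and of \<open>Q\<close>, one factor being \<open>1\<close>.\<close>
    have "x \<in> P" if "x \<in> T" for x
    proof (rule ccontr)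
      assume "x \<notin> P"
      then have "x \<otimes> \<one> \<in> ?S" using that Q1 T.Icarr by blast
      then show False using that T by (auto simp: T.Icarr)
    qed
    moreover have "x \<in> Q" if "x \<in> T" for x
    proof (rule ccontr)
      assume "x \<notin> Q"
      then have "\<one> \<otimes> x \<in> ?S" using that P1 T.Icarr by blast
      then show False using that T by (auto simp: T.Icarr)
    qed
    ultimately have "T = P" "T = Q"
      using P Q T(1) by (auto simp: minimal_primes_def)
    with \<open>P \<noteq> Q\<close> show False by simp
  qed
  then obtain a b where "a \<in> carrier R - P" "b \<in> carrier R - Q" "\<zero> = a \<otimes> b" by blast
  with that show ?thesis by metis
qed

lemma (in cring) cgenideal_prod_zero:
  assumes "x \<in> carrier R" and "y \<in> carrier R" and "x \<otimes> y = \<zero>"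
  shows "(PIdl x) \<cdot> (PIdl y) = {\<zero>}"
proof -
  have "(PIdl x) \<cdot> (PIdl y) = Idl (PIdl \<zero>)"
    using assms by (simp add: ideal_prod_eq_genideal cgenideal_ideal cgenideal_prod)
  also have "PIdl \<zero> = {\<zero>}"
    by (simp add: cgenideal_eq_genideal genideal_zero)
  finally show ?thesis by (simp add: genideal_zero)
qed

text \<open>
  Reducedness cannot be dropped: a non-zero \<open>x\<close> with \<open>x\<^sup>2 = 0\<close>, taken with \<open>y = x\<close>, satisfies
  all the other hypotheses.
\<close>

lemma (in cring) reduced_ring_cgenideal_neq:
  assumes "reduced_ring R" and "x \<in> carrier R" and "y \<in> carrier R"
    and "x \<otimes> y = \<zero>" and "x \<noteq> \<zero>"
  shows "PIdl x \<noteq> PIdl y"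
proof
  assume "PIdl x = PIdl y"
  then have "x \<in> PIdl y" using cgenideal_self[OF assms(2)] by simp
  then obtain r where r: "r \<in> carrier R" "x = r \<otimes> y" by (auto simp: cgenideal_def)
  have "x [^] (2::nat) = x \<otimes> (r \<otimes> y)"
    using assms(2) r by (simp add: numeral_2_eq_2)
  also have "\<dots> = r \<otimes> (x \<otimes> y)"
    using assms r(1) by (simp add: m_lcomm)
  also have "\<dots> = \<zero>"
    using assms r(1) by simp
  finally have "x = \<zero>" using assms(1,2) unfolding reduced_ring_def by blast
  with \<open>x \<noteq> \<zero>\<close> show False ..
qed

lemma (in cring) reduced_ring_cgenideal_arc:
  assumes "reduced_ring R" and x: "x \<in> carrier R" "x \<noteq> \<zero>" and y: "y \<in> carrier R" "y \<noteq> \<zero>"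
    and xy: "x \<otimes> y = \<zero>"
  shows "(PIdl x, PIdl y) \<in> parcs (annihilating_ideal_graph R)"
proof -
  have yx: "y \<otimes> x = \<zero>" using x y xy by (simp add: m_comm)
  have "PIdl x \<noteq> {\<zero>}" "PIdl y \<noteq> {\<zero>}"
    using cgenideal_self x y by blast+
  then have "PIdl x \<in> annihilating_ideals R" "PIdl y \<in> annihilating_ideals R"
    using cgenideal_ideal x y cgenideal_prod_zero xy yx
    unfolding annihilating_ideals_def by blast+
  then show ?thesis
    using reduced_ring_cgenideal_neq[of x y] cgenideal_prod_zero assms
    by (simp add: annihilating_ideal_graph_def)
qed

lemma girth_eq_3_if_triangle:
  assumes "pair_loopfree_digraph G"
    and arcs: "(u, v) \<in> parcs G" "(v, w) \<in> parcs G" "(w, u) \<in> parcs G"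
  shows "girth (with_proj G) = 3"
proof -
  interpret pair_loopfree_digraph G by fact
  have "u \<in> pverts G" "u \<noteq> v" "v \<noteq> w" "w \<noteq> u"
    using arcs in_arcsD1 pair_no_loops by force+
  then have "pre_digraph.cycle (with_proj G) [(u, v), (v, w), (w, u)]"
    using arcs unfolding pre_digraph.cycle_def pre_digraph.awalk_def
    by (intro exI[of _ u]) auto
  then have "enat 3 \<in> {enat (length p) | p. pre_digraph.cycle (with_proj G) p \<and> 3 \<le> length p}"
    by (intro CollectI exI[of _ "[(u, v), (v, w), (w, u)]"]) simp
  then have "girth (with_proj G) \<le> enat 3"
    unfolding girth_def by (rule Inf_lower)
  moreover have "enat 3 \<le> girth (with_proj G)"
    unfolding girth_def by (rule Inf_greatest) auto
  ultimately show ?thesis by (simp add: numeral_eq_enat)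
qed

theorem corollary2p19:
  fixes R :: "('a, 'b) ring_scheme"
  assumes "cring R"
    and "reduced_ring R"
    and "infinite (minimal_primes R) \<or> card (minimal_primes R) > 2"
  shows "girth (with_proj (annihilating_ideal_graph R)) = 3"
proof -
  interpret cring R by fact
  interpret G: pair_bidirected_digraph "annihilating_ideal_graph R"
    by (rule pair_bidirected_digraph_annihilating_ideal_graph)
  obtain \<P> where "\<P> \<subseteq> minimal_primes R" "card \<P> = 3"
  proof (cases "finite (minimal_primes R)")
    case True
    then show ?thesis
      using assms(3) obtain_subset_with_card_n[of 3 "minimal_primes R"] that by auto
  next
    case False
    then show ?thesis using infinite_arbitrarily_large that by metis
  qed
  then obtain P Q T where "{P, Q, T} \<subseteq> minimal_primes R" "P \<noteq> Q" "Q \<noteq> T" "P \<noteq> T"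
    by (metis card_3_iff)
  then have min: "P \<in> minimal_primes R" "Q \<in> minimal_primes R" "T \<in> minimal_primes R"
    and neq: "P \<noteq> Q" "Q \<noteq> T" "P \<noteq> T"
    by simp_all
  interpret P: primeideal P R using min by (simp add: minimal_primes_def)
  interpret Q: primeideal Q R using min by (simp add: minimal_primes_def)
  interpret T: primeideal T R using min by (simp add: minimal_primes_def)
  obtain a b where ab: "a \<in> carrier R - P" "b \<in> carrier R - Q" "a \<otimes>\<^bsub>R\<^esub> b = \<zero>\<^bsub>R\<^esub>"
    using separate_minimal_primes min neq by metis
  obtain c d where cd: "c \<in> carrier R - Q" "d \<in> carrier R - T" "c \<otimes>\<^bsub>R\<^esub> d = \<zero>\<^bsub>R\<^esub>"
    using separate_minimal_primes min neq by metis
  obtain e f where ef: "e \<in> carrier R - P" "f \<in> carrier R - T" "e \<otimes>\<^bsub>R\<^esub> f = \<zero>\<^bsub>R\<^esub>"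
    using separate_minimal_primes min neq by metis
  define x where "x = a \<otimes>\<^bsub>R\<^esub> e"
  define y where "y = b \<otimes>\<^bsub>R\<^esub> c"
  define z where "z = d \<otimes>\<^bsub>R\<^esub> f"
  have carr: "x \<in> carrier R" "y \<in> carrier R" "z \<in> carrier R"
    using ab cd ef by (auto simp: x_def y_def z_def)
  have "x \<notin> P" "y \<notin> Q" "z \<notin> T"
    using ab cd ef P.I_prime[of a e] Q.I_prime[of b c] T.I_prime[of d f]
    by (auto simp: x_def y_def z_def)
  then have nz: "x \<noteq> \<zero>\<^bsub>R\<^esub>" "y \<noteq> \<zero>\<^bsub>R\<^esub>" "z \<noteq> \<zero>\<^bsub>R\<^esub>"
    using P.zero_closed Q.zero_closed T.zero_closed by auto
  have "x \<otimes>\<^bsub>R\<^esub> y = (a \<otimes>\<^bsub>R\<^esub> b) \<otimes>\<^bsub>R\<^esub> (e \<otimes>\<^bsub>R\<^esub> c)"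
    "y \<otimes>\<^bsub>R\<^esub> z = (c \<otimes>\<^bsub>R\<^esub> d) \<otimes>\<^bsub>R\<^esub> (b \<otimes>\<^bsub>R\<^esub> f)"
    "z \<otimes>\<^bsub>R\<^esub> x = (e \<otimes>\<^bsub>R\<^esub> f) \<otimes>\<^bsub>R\<^esub> (a \<otimes>\<^bsub>R\<^esub> d)"
    using ab(1,2) cd(1,2) ef(1,2) by (simp_all add: x_def y_def z_def m_ac)
  then have "x \<otimes>\<^bsub>R\<^esub> y = \<zero>\<^bsub>R\<^esub>" "y \<otimes>\<^bsub>R\<^esub> z = \<zero>\<^bsub>R\<^esub>" "z \<otimes>\<^bsub>R\<^esub> x = \<zero>\<^bsub>R\<^esub>"
    using ab cd ef by auto
  then show ?thesis
    using carr nz assms(2)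
    by (intro girth_eq_3_if_triangle[of _ "PIdl\<^bsub>R\<^esub> x" "PIdl\<^bsub>R\<^esub> y" "PIdl\<^bsub>R\<^esub> z"]
        reduced_ring_cgenideal_arc G.pair_loopfree_digraph_axioms)
qed

end
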